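(* Let $A$ be a countable set with an enumerator $e$, i.e., a function $e:A\to A$ and an element $a_0\in A$ such that every $a\in A$ equals $e^i(a_0)$ for some $i\in\mathbb{N}$. Let $x$ and $y$ be representations of $A$. If $e\in\mathrm{comp}(x)$ and $e\in\mathrm{comp}(y)$, then $x$ and $y$ are transformationally equivalent.
   Context: $\mathbb{T}$ denotes the set of tapes over a fixed finite alphabet with finitely many non-blank symbols. For $Q\subseteq\mathbb{T}$, a function with domain $Q$ and values in $\mathbb{T}$ is computable if some Turing machine, on every input $\tau\in Q$, halts with output equal to the function's value (nothing is required outside $Q$). A representation of $A$ is an injective function $A\to\mathbb{T}$. $\mathrm{comp}(x)$ is the set of functions $g$ with domain $A$ and values in $A$ such that $x\circ g\circ x^{-1}$ is computable on $x(A)$. Representations $x,y$ are transformationally equivalent if $y\circ x^{-1}$ (on $x(A)$) and $x\circ y^{-1}$ (on $y(A)$) are both computable. Standing assumptions: a fixed tape pairing bijection with computable duplication, swap, projections and partial application, and a Turing machine deciding equality of the two components of a pair.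
   Formalization: Turing machines receive the input tape with end markers outside the interval spanned by the origin and the non-blank cells, and may use auxiliary symbols; without end markers the standing assumptions on the tape pairing are contradictory. *)

theory Defs
  imports Main "HOL-Library.FuncSet" "HOL-Library.Countable_Set" "HOL-Library.Finite_Map"
begin

(* The fixed finite alphabet is 's option with 's finite, None being the blank. A tape assigns
   a symbol to every cell of the two-way infinite line; finitely many non-blank symbols means
   that it is a finite partial map. Gaps of blanks between non-blank cells are allowed. *)
type_synonym 's tape = "(int, 's) fmap"

(* While running, a machine may use besides the alphabet any finite number of auxiliary working
   symbols Aux n. The symbol Void fills the cells outside the extent of the input tape. *)
datatype 's cell = Void | Cell "'s option" | Aux nat

datatype move = MoveLeft | Stay | MoveRight

fun displacement :: "move \<Rightarrow> int" where
  "displacement MoveLeft = -1"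
| "displacement Stay = 0"
| "displacement MoveRight = 1"

(* A machine is its finite transition table, so it has finitely many states and working symbols.
   The start state is 0, and the machine halts when the table has no entry. *)
type_synonym 's tm = "(nat \<times> 's cell, nat \<times> 's cell \<times> move) fmap"

(* state, contents of the cells, head position *)
type_synonym 's config = "nat \<times> (int \<Rightarrow> 's cell) \<times> int"

definition step :: "'s tm \<Rightarrow> 's config \<Rightarrow> 's config \<Rightarrow> bool" where
  "step M = (\<lambda>(q, t, h) (q', t', h'). \<exists>b d. fmlookup M (q, t h) = Some (q', b, d) \<and>
     t' = t(h := b) \<and> h' = h + displacement d)"

definition halted :: "'s tm \<Rightarrow> 's config \<Rightarrow> bool" where
  "halted M = (\<lambda>(q, t, h). fmlookup M (q, t h) = None)"

(* The extent is the smallest interval containing the origin and all non-blank cells. *)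
definition extent :: "'s tape \<Rightarrow> int set" where
  "extent \<tau> = {i. i = 0 \<or> (\<exists>j \<in> fmdom' \<tau>. 0 \<le> i \<and> i \<le> j \<or> j \<le> i \<and> i \<le> 0)}"

(* The input is presented delimited by Void on both sides. This matters: as tapes may contain
   arbitrarily long gaps of blanks, a machine that cannot see where the non-blank part of its
   input ends could not even decide whether the input is blank, and no pairing as below would
   exist. *)
definition load :: "'s tape \<Rightarrow> int \<Rightarrow> 's cell" where
  "load \<tau> i = (if i \<in> extent \<tau> then Cell (fmlookup \<tau> i) else Void)"

(* All symbols that are not in the alphabet read as blank in the output. *)
fun content :: "'s cell \<Rightarrow> 's option" where
  "content (Cell s) = s"
| "content Void = None"
| "content (Aux n) = None"

definition halts_with :: "'s tm \<Rightarrow> 's tape \<Rightarrow> 's tape \<Rightarrow> bool" where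
  "halts_with M \<tau> \<rho> \<longleftrightarrow> (\<exists>q t h. (step M)\<^sup>*\<^sup>* (0, load \<tau>, 0) (q, t, h) \<and> halted M (q, t, h) \<and>
     (\<forall>i. fmlookup \<rho> i = content (t i)))"

definition computable_on :: "('s::finite) tape set \<Rightarrow> ('s tape \<Rightarrow> 's tape) \<Rightarrow> bool" where
  "computable_on Q f \<longleftrightarrow> (\<exists>M. \<forall>\<tau>\<in>Q. halts_with M \<tau> (f \<tau>))"

(* The last two clauses are partial application (pairing with a fixed first component) and the
   decision of equality, the verdict being one of two distinct fixed output tapes. *)
definition computable_pairing :: "(('s::finite) tape \<times> 's tape \<Rightarrow> 's tape) \<Rightarrow> bool" where
  "computable_pairing p \<longleftrightarrow> bij p \<and>
     computable_on UNIV (\<lambda>\<tau>. p (\<tau>, \<tau>)) \<and>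
     computable_on UNIV (\<lambda>\<rho>. p (prod.swap (inv p \<rho>))) \<and>
     computable_on UNIV (\<lambda>\<rho>. fst (inv p \<rho>)) \<and>
     computable_on UNIV (\<lambda>\<rho>. snd (inv p \<rho>)) \<and>
     (\<forall>\<sigma>. computable_on UNIV (\<lambda>\<tau>. p (\<sigma>, \<tau>))) \<and>
     (\<exists>yes no. yes \<noteq> no \<and>
        computable_on UNIV (\<lambda>\<rho>. if fst (inv p \<rho>) = snd (inv p \<rho>) then yes else no))"

definition representation :: "'a set \<Rightarrow> ('a \<Rightarrow> ('s::finite) tape) \<Rightarrow> bool" where
  "representation A x \<longleftrightarrow> inj_on x A"

definition comp_wrt :: "'a set \<Rightarrow> ('a \<Rightarrow> ('s::finite) tape) \<Rightarrow> ('a \<Rightarrow> 'a) set" where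
  "comp_wrt A x = {g \<in> A \<rightarrow> A. computable_on (x ` A) (x \<circ> g \<circ> inv_into A x)}"

definition transformationally_equivalent ::
    "'a set \<Rightarrow> ('a \<Rightarrow> ('s::finite) tape) \<Rightarrow> ('a \<Rightarrow> 's tape) \<Rightarrow> bool" where
  "transformationally_equivalent A x y \<longleftrightarrow>
     computable_on (x ` A) (y \<circ> inv_into A x) \<and> computable_on (y ` A) (x \<circ> inv_into A y)"

definition enumerator :: "'a set \<Rightarrow> ('a \<Rightarrow> 'a) \<Rightarrow> bool" where
  "enumerator A e \<longleftrightarrow> e \<in> A \<rightarrow> A \<and> (\<exists>a\<^sub>0\<in>A. \<forall>a\<in>A. \<exists>i. a = (e ^^ i) a\<^sub>0)"

end

(* On input x(a), a three-track machine keeps the input on one track and x(b), y(b) on the two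
   others, starting with the constant tapes x(a0), y(a0). As long as x(b) differs from the input it
   runs the machines for e on both working tracks, which replaces b by e(b). Since a is some
   e^i(a0), equality is eventually reached, and then b = a by injectivity of x, so that the last
   track can be output. The one delicate point is that between two runs the output on a track must
   be brought into the exact form of an input again: auxiliary symbols become blanks, and the cells
   outside the extent become Void. *)
theory Submission
  imports Defs
begin

section \<open>Machines over arbitrary states and symbols\<close>

text \<open>Arbitrary types let states carry flags and symbols carry several tracks; finiteness
  enters only in \<open>finite_machine_encoding\<close>.\<close>

definition mstep ::
    "('q \<Rightarrow> 'g \<Rightarrow> ('q \<times> 'g \<times> move) option) \<Rightarrow> 'q \<times> (int \<Rightarrow> 'g) \<times> int \<Rightarrow> 'q \<times> (int \<Rightarrow> 'g) \<times> int \<Rightarrow> bool" where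
  "mstep \<delta> = (\<lambda>(q, t, h) (q', t', h'). \<exists>b d. \<delta> q (t h) = Some (q', b, d) \<and>
     t' = t(h := b) \<and> h' = h + displacement d)"

lemma mstepI:
  assumes "\<delta> q (t h) = Some (q', b, d)" "t' = t(h := b)" "h' = h + displacement d"
  shows "(mstep \<delta>)\<^sup>*\<^sup>* (q, t, h) (q', t', h')"
  using assms by (intro r_into_rtranclp) (auto simp: mstep_def)

text \<open>The state may depend on the position, so a flag collected on the way can be written as a
  predicate of the cell reached.\<close>

lemma sweep_right:
  assumes "\<And>i. a \<le> i \<Longrightarrow> i < b \<Longrightarrow> \<delta> (q i) (t i) = Some (q (i + 1), t' i, MoveRight)"
    and "a \<le> b" and "\<And>i. i < a \<or> b \<le> i \<Longrightarrow> t' i = t i"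
  shows "(mstep \<delta>)\<^sup>*\<^sup>* (q a, t, a) (q b, t', b)"
  using assms(2,1,3)
proof (induction b arbitrary: t' rule: int_ge_induct)
  case (base t')
  have "t' = t" by (rule ext, rule base.prems(2)) linarith
  then show ?case by simp
next
  case (step k t')
  have "(mstep \<delta>)\<^sup>*\<^sup>* (q a, t, a) (q k, t'(k := t k), k)"
    by (rule step.IH) (use step.prems in auto)
  moreover have "(mstep \<delta>)\<^sup>*\<^sup>* (q k, t'(k := t k), k) (q (k + 1), t', k + 1)"
    by (rule mstepI[where b = "t' k" and d = MoveRight]) (use step.prems(1)[of k] step.hyps in auto)
  ultimately show ?case by (rule rtranclp_trans)
qed

lemma sweep_left:
  assumes "\<And>i. a < i \<Longrightarrow> i \<le> b \<Longrightarrow> \<delta> (q i) (t i) = Some (q (i - 1), t' i, MoveLeft)"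
    and "a \<le> b" and "\<And>i. i \<le> a \<or> b < i \<Longrightarrow> t' i = t i"
  shows "(mstep \<delta>)\<^sup>*\<^sup>* (q b, t, b) (q a, t', a)"
  using assms(2,1,3)
proof (induction a arbitrary: t' rule: int_le_induct)
  case (base t')
  have "t' = t" by (rule ext, rule base.prems(2)) linarith
  then show ?case by simp
next
  case (step k t')
  have "(mstep \<delta>)\<^sup>*\<^sup>* (q b, t, b) (q k, t'(k := t k), k)"
    by (rule step.IH) (use step.prems in auto)
  moreover have "(mstep \<delta>)\<^sup>*\<^sup>* (q k, t'(k := t k), k) (q (k - 1), t', k - 1)"
    by (rule mstepI[where b = "t' k" and d = MoveLeft]) (use step.prems(1)[of k] step.hyps in auto)
  ultimately show ?case by (rule rtranclp_trans)
qed

text \<open>As \<open>\<delta>\<close> is closed on finite sets, injective codes of states and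
  symbols turn it into a finite table. The result is phrased with \<open>halts_with\<close> so that
  later arguments never touch tables.\<close>

lemma finite_machine_encoding:
  fixes \<delta> :: "'q \<Rightarrow> 'g \<Rightarrow> ('q \<times> 'g \<times> move) option" and enc :: "'g \<Rightarrow> 's cell"
  assumes "finite S" "finite G" "q0 \<in> S"
    and closed: "\<And>q s q' s' d. q \<in> S \<Longrightarrow> s \<in> G \<Longrightarrow> \<delta> q s = Some (q', s', d) \<Longrightarrow> q' \<in> S \<and> s' \<in> G"
    and enc: "inj_on enc G"
  obtains M :: "'s tm" where
    "\<And>t q t' h' \<rho> \<tau>. (mstep \<delta>)\<^sup>*\<^sup>* (q0, t, 0) (q, t', h') \<Longrightarrow> range t \<subseteq> G \<Longrightarrow> \<delta> q (t' h') = None \<Longrightarrow>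
       load \<tau> = enc \<circ> t \<Longrightarrow> (\<And>i. fmlookup \<rho> i = content (enc (t' i))) \<Longrightarrow> halts_with M \<tau> \<rho>"
proof -
  obtain f :: "'q \<Rightarrow> nat" where f: "inj_on f S"
    using finite_imp_inj_to_nat_seg[OF \<open>finite S\<close>] by blast
  \<comment> \<open>The start state must be 0, so \<open>Suc\<close> shifts all other codes away
    from it.\<close>
  define encq where "encq q = (if q = q0 then 0 else Suc (f q))" for q
  have encq: "inj_on encq S"
    using f by (auto simp: inj_on_def encq_def)
  define code where "code = (\<lambda>(q, s). (encq q, enc s))"
  have code: "inj_on code (S \<times> G)"
    using enc encq by (auto simp: inj_on_def code_def)
  define tab where "tab nc = (if nc \<in> code ` (S \<times> G) then
      map_option (\<lambda>(q', s', d). (encq q', enc s', d)) (case_prod \<delta> (inv_into (S \<times> G) code nc))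
    else None)" for nc
  define M where "M = Abs_fmap tab"
  have "dom tab \<subseteq> code ` (S \<times> G)"
    by (auto simp: tab_def split: if_splits)
  then have "finite (dom tab)"
    using \<open>finite S\<close> \<open>finite G\<close> by (meson finite_SigmaI finite_imageI finite_subset)
  then have lookup: "fmlookup M = tab"
    unfolding M_def by (simp add: Abs_fmap_inverse)
  have tab: "tab (encq q, enc s) = map_option (\<lambda>(q', s', d). (encq q', enc s', d)) (\<delta> q s)"
    if "q \<in> S" "s \<in> G" for q s
  proof -
    have "inv_into (S \<times> G) code (code (q, s)) = (q, s)"
      using code that by (simp add: inv_into_f_f)
    moreover have "code (q, s) = (encq q, enc s)" by (simp add: code_def)
    moreover have "(encq q, enc s) \<in> code ` (S \<times> G)"
      using that \<open>code (q, s) = _\<close> by (metis SigmaI imageI)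
    ultimately show ?thesis by (simp add: tab_def)
  qed
  \<comment> \<open>Staying within \<open>S\<close> and \<open>G\<close> is part of the induction,
    as the table is known to agree with \<open>\<delta>\<close> only there.\<close>
  have sim: "q \<in> S \<and> range t' \<subseteq> G \<and> (step M)\<^sup>*\<^sup>* (0, enc \<circ> t, 0) (encq q, enc \<circ> t', h')"
    if "(mstep \<delta>)\<^sup>*\<^sup>* (q0, t, 0) (q, t', h')" "range t \<subseteq> G" for t q t' h'
    using that
  proof (induction "(q, t', h')" arbitrary: q t' h' rule: rtranclp_induct)
    case base
    then show ?case using \<open>q0 \<in> S\<close> by (auto simp: encq_def)
  next
    case (step z)
    obtain q1 t1 h1 where z: "z = (q1, t1, h1)" by (cases z)
    obtain b d where *: "\<delta> q1 (t1 h1) = Some (q, b, d)" "t' = t1(h1 := b)" "h' = h1 + displacement d"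
      using step.hyps(2) z by (auto simp: mstep_def)
    have IH: "q1 \<in> S" "range t1 \<subseteq> G" "(step M)\<^sup>*\<^sup>* (0, enc \<circ> t, 0) (encq q1, enc \<circ> t1, h1)"
      using step.hyps(3)[OF z] step.prems by auto
    have G: "t1 h1 \<in> G" using IH(2) by auto
    have "step M (encq q1, enc \<circ> t1, h1) (encq q, enc \<circ> t', h')"
      unfolding step_def using * tab[OF IH(1) G] by (auto simp: lookup fun_eq_iff)
    moreover have "q \<in> S" "b \<in> G" using closed[OF IH(1) G *(1)] by auto
    ultimately show ?case using IH * by (auto intro: rtranclp.rtrancl_into_rtrancl)
  qed
  show thesis
  proof (rule that)
    fix t q t' h' \<rho> \<tau>
    assume run: "(mstep \<delta>)\<^sup>*\<^sup>* (q0, t, 0) (q, t', h')" "range t \<subseteq> G" and stop: "\<delta> q (t' h') = None"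
      and load: "load \<tau> = enc \<circ> t" and out: "\<And>i. fmlookup \<rho> i = content (enc (t' i))"
    note s = sim[OF run]
    then have "tab (encq q, enc (t' h')) = None" using tab[of q "t' h'"] stop by auto
    then show "halts_with M \<tau> \<rho>"
      unfolding halts_with_def halted_def using s load out
      by (intro exI[of _ "encq q"] exI[of _ "enc \<circ> t'"] exI[of _ h']) (auto simp: lookup)
  qed
qed

section \<open>Extents\<close>

text \<open>The non-blank cells are finite in number, so together with the origin they have a least
  and a greatest element.\<close>

lemma extent_interval: "\<exists>l r. l \<le> 0 \<and> 0 \<le> r \<and> extent \<tau> = {l..r}"
proof -
  define D where "D = insert 0 (fmdom' \<tau>)"
  have fin: "finite D" "D \<noteq> {}" by (auto simp: D_def)
  have bounds: "Min D \<le> j \<and> j \<le> Max D" if "j \<in> D" for j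
    using fin that by simp
  have zero: "Min D \<le> 0" "0 \<le> Max D"
    using bounds[of 0] by (auto simp: D_def)
  have "extent \<tau> \<subseteq> {Min D..Max D}"
  proof
    fix i assume "i \<in> extent \<tau>"
    then obtain j where "j \<in> D" "0 \<le> i \<and> i \<le> j \<or> j \<le> i \<and> i \<le> 0"
      by (auto simp: extent_def D_def)
    then show "i \<in> {Min D..Max D}"
      using bounds[of j] zero by auto
  qed
  moreover have "{Min D..Max D} \<subseteq> extent \<tau>"
  proof
    fix i assume "i \<in> {Min D..Max D}"
    moreover have "Min D \<in> D" "Max D \<in> D" using fin by auto
    ultimately obtain j k where "j \<in> D" "j \<le> i" "k \<in> D" "i \<le> k" by auto
    then show "i \<in> extent \<tau>"
      by (cases i "0 :: int" rule: linorder_cases) (auto simp: extent_def D_def)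
  qed
  ultimately show ?thesis using zero by blast
qed

lemma content_load: "content (load \<tau> i) = fmlookup \<tau> i"
  by (auto simp: load_def extent_def fmdom'_notI fmlookup_dom'_iff)

lemma load_zero: "load \<tau> 0 = Cell (fmlookup \<tau> 0)"
  by (simp add: load_def extent_def)

text \<open>Here and in \<open>load_neg\<close>, only non-blank cells at or beyond \<open>i\<close>
  matter, so a sweep towards the origin can decide with one flag whether \<open>i\<close> is in the
  extent.\<close>

lemma load_pos: "0 < i \<Longrightarrow> load \<tau> i = (if \<exists>j\<ge>i. fmlookup \<tau> j \<noteq> None then Cell (fmlookup \<tau> i) else Void)"
  by (auto simp: load_def extent_def fmlookup_dom'_iff)

lemma load_neg: "i < 0 \<Longrightarrow> load \<tau> i = (if \<exists>j\<le>i. fmlookup \<tau> j \<noteq> None then Cell (fmlookup \<tau> i) else Void)"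
  by (auto simp: load_def extent_def fmlookup_dom'_iff)

lemma load_outside:
  assumes "\<And>j. j < l \<or> r < j \<Longrightarrow> fmlookup \<tau> j = None" "l \<le> 0" "0 \<le> r" "i < l \<or> r < i"
  shows "load \<tau> i = Void"
proof (cases "0 < i")
  case True
  then have "fmlookup \<tau> j = None" if "i \<le> j" for j
    using that assms by (intro assms(1)) auto
  then show ?thesis using True by (simp add: load_pos)
next
  case False
  then have "fmlookup \<tau> j = None" if "j \<le> i" for j
    using that assms by (intro assms(1)) auto
  then show ?thesis using False assms by (simp add: load_neg)
qed

section \<open>The search machine\<close>

datatype mark = Fresh | Visited | Origin

text \<open>The components of a symbol are a mark, the input track and the two working tracks. The cells
  not marked Fresh form an interval around the origin, so that from any of them the machine finds
  the origin by running right to the first Fresh cell and then left.\<close>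

type_synonym 's sym = "mark \<times> 's cell \<times> (bool \<Rightarrow> 's cell)"

text \<open>The integers are head positions. The flag of \<open>Cmp\<close> says that no difference
  has been met, the second one of \<open>TrimL\<close> and \<open>TrimR\<close> that the extent has
  been entered. The other Booleans name a working track, \<open>True\<close> being the one compared
  with the input.\<close>

datatype ctrl =
    InitLeft int | InitRight int
  | SeekCmp | SeekTrim bool
  | Cmp bool | ToOrigin
  | Sim bool nat
  | TrimL bool bool | LeftEnd bool | TrimR bool bool
  | Out

definition tracks :: "int \<Rightarrow> int \<Rightarrow> (int \<Rightarrow> 's cell) \<Rightarrow> (bool \<Rightarrow> int \<Rightarrow> 's cell) \<Rightarrow> int \<Rightarrow> 's sym" where
  "tracks l r I T i =
     (if i = 0 then Origin else if l \<le> i \<and> i \<le> r then Visited else Fresh, I i, \<lambda>b. T b i)"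

text \<open>Ties the marks of \<open>tracks l r\<close> to the contents: a sweep over the visited
  interval misses no cell other than Void ones.\<close>

definition framed :: "int \<Rightarrow> int \<Rightarrow> (int \<Rightarrow> 's cell) \<Rightarrow> (bool \<Rightarrow> int \<Rightarrow> 's cell) \<Rightarrow> bool" where
  "framed l r I T \<longleftrightarrow> l \<le> 0 \<and> 0 \<le> r \<and> (\<forall>i. i < l \<or> r < i \<longrightarrow> I i = Void \<and> (\<forall>b. T b i = Void))"

definition touch :: "mark \<Rightarrow> mark" where
  "touch m = (if m = Fresh then Visited else m)"

definition trim :: "bool \<Rightarrow> bool \<Rightarrow> (bool \<Rightarrow> 's cell) \<Rightarrow> bool \<Rightarrow> 's cell" where
  "trim b keep T = T(b := if keep then Cell (content (T b)) else Void)"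

text \<open>The machine M b works on track b, which initially holds the constant tape c b.\<close>

locale search =
  fixes M :: "bool \<Rightarrow> ('s::finite) tm" and c :: "bool \<Rightarrow> 's tape" and N :: int
  assumes N: "0 \<le> N" "\<And>b. extent (c b) \<subseteq> {-N..N}"
begin

text \<open>\<open>Out\<close> on a Fresh cell is the only halting situation; halting of
  \<open>M b\<close> leads to trimming instead. \<open>TrimL\<close> always keeps the origin, since
  it lies in every extent.\<close>

primrec \<delta> :: "ctrl \<Rightarrow> 's sym \<Rightarrow> (ctrl \<times> 's sym \<times> move) option" where
  "\<delta> (InitLeft k) = (\<lambda>s. Some (if -N < k then (InitLeft (k - 1), s, MoveLeft) else (InitRight k, s, Stay)))"
| "\<delta> (InitRight k) = (\<lambda>(m, a, T). Some (if k < N then InitRight (k + 1) else SeekCmp,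
     (if k = 0 then Origin else Visited, a, \<lambda>b. load (c b) k), MoveRight))"
| "\<delta> SeekCmp = (\<lambda>(m, a, T). Some (if m = Fresh then (Cmp True, (m, a, T), MoveLeft)
     else (SeekCmp, (m, a, T), MoveRight)))"
| "\<delta> (SeekTrim b) = (\<lambda>(m, a, T). Some (if m = Fresh then (TrimL b False, (m, a, T), MoveLeft)
     else (SeekTrim b, (m, a, T), MoveRight)))"
| "\<delta> (Cmp f) = (\<lambda>(m, a, T). Some (if m = Fresh then (if f then Out else ToOrigin, (m, a, T), MoveRight)
     else (Cmp (f \<and> content a = content (T True)), (m, a, T), MoveLeft)))"
| "\<delta> ToOrigin = (\<lambda>(m, a, T). Some (if m = Origin then (Sim True 0, (m, a, T), Stay)
     else (ToOrigin, (m, a, T), MoveRight)))"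
| "\<delta> (Sim b q) = (\<lambda>(m, a, T). Some (case fmlookup (M b) (q, T b) of
     Some (q', s, d) \<Rightarrow> (Sim b q', (touch m, a, T(b := s)), d)
   | None \<Rightarrow> (SeekTrim b, (touch m, a, T), Stay)))"
| "\<delta> (TrimL b f) = (\<lambda>(m, a, T). (let g = f \<or> content (T b) \<noteq> None \<or> m = Origin in
     Some (if m = Origin then LeftEnd b else TrimL b g, (m, a, trim b g T), MoveLeft)))"
| "\<delta> (LeftEnd b) = (\<lambda>(m, a, T). Some (if m = Fresh then (TrimR b False, (m, a, T), MoveRight)
     else (LeftEnd b, (m, a, T), MoveLeft)))"
| "\<delta> (TrimR b f) = (\<lambda>(m, a, T). (if m = Origin
     then Some (if b then Sim False 0 else SeekCmp, (m, a, T), Stay)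
     else let g = f \<or> content (T b) \<noteq> None in Some (TrimR b g, (m, a, trim b g T), MoveRight)))"
| "\<delta> Out = (\<lambda>(m, a, T). (if m = Fresh then None
     else Some (Out, (Visited, Cell (content (T False)), \<lambda>b. Void), MoveRight)))"

section \<open>Runs of the individual phases\<close>

abbreviation reaches (infix "\<leadsto>" 50) where "reaches \<equiv> (mstep \<delta>)\<^sup>*\<^sup>*"

text \<open>Shared by both seeking states. The head may already stand on the first Fresh cell, hence
  the bound \<open>r + 1\<close>.\<close>

lemma seek:
  assumes "l \<le> 0" "0 \<le> r" "l \<le> h" "h \<le> r + 1"
    and "\<And>s. \<delta> q s = Some (if fst s = Fresh then (q', s, MoveLeft) else (q, s, MoveRight))"
  shows "(q, tracks l r I T, h) \<leadsto> (q', tracks l r I T, r)"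
proof -
  have "(q, tracks l r I T, h) \<leadsto> (q, tracks l r I T, r + 1)"
    by (rule sweep_right) (use assms in \<open>auto simp: tracks_def\<close>)
  also have "(q, tracks l r I T, r + 1) \<leadsto> (q', tracks l r I T, r)"
    by (rule mstepI[where b = "tracks l r I T (r + 1)" and d = MoveLeft])
      (use assms in \<open>auto simp: tracks_def\<close>)
  finally (rtranclp_trans) show ?thesis .
qed

text \<open>Each half is swept from its outer end to the origin; by \<open>load_pos\<close> and
  \<open>load_neg\<close>, the flag for a non-blank cell already met decides between an alphabet
  cell and Void.\<close>

lemma trim_run:
  assumes fr: "framed l r I T" and \<rho>: "\<And>i. fmlookup \<rho> i = content (T b i)"
  shows "(TrimL b False, tracks l r I T, r) \<leadsto>
    (if b then Sim False 0 else SeekCmp, tracks l r I (T(b := load \<rho>)), 0)"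
proof -
  have lr: "l \<le> 0" "0 \<le> r" using fr by (auto simp: framed_def)
  have out: "fmlookup \<rho> i = None" if "i < l \<or> r < i" for i
    using fr that by (auto simp: framed_def \<rho>)
  \<comment> \<open>The track with its right half, and then also the origin, in input form.\<close>
  define T1 where "T1 = T(b := (\<lambda>i. if 0 < i then load \<rho> i else T b i))"
  define T2 where "T2 = T(b := (\<lambda>i. if 0 \<le> i then load \<rho> i else T b i))"
  \<comment> \<open>\<open>U i\<close> and \<open>V i\<close> are the flags on arrival at cell
    \<open>i\<close>, hence the strict inequalities; after cell \<open>i\<close> they are
    \<open>U (i - 1)\<close> and \<open>V (i + 1)\<close>.\<close>
  define U where "U i \<longleftrightarrow> (\<exists>j>i. fmlookup \<rho> j \<noteq> None)" for i
  define V where "V i \<longleftrightarrow> (\<exists>j<i. fmlookup \<rho> j \<noteq> None)" for i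
  have gt: "i - 1 < j \<longleftrightarrow> i \<le> j" and lt: "j < i + 1 \<longleftrightarrow> j \<le> i" for i j :: int by auto
  have U: "U (i - 1) \<longleftrightarrow> U i \<or> fmlookup \<rho> i \<noteq> None" for i
    unfolding U_def gt order_le_less by blast
  have V: "V (i + 1) \<longleftrightarrow> V i \<or> fmlookup \<rho> i \<noteq> None" for i
    unfolding V_def lt order_le_less by blast
  have loadU: "load \<rho> i = (if U (i - 1) then Cell (fmlookup \<rho> i) else Void)" if "0 < i" for i
    using that by (simp add: load_pos U_def gt)
  have loadV: "load \<rho> i = (if V (i + 1) then Cell (fmlookup \<rho> i) else Void)" if "i < 0" for i
    using that by (simp add: load_neg V_def lt)
  have "\<not> U r" using out by (auto simp: U_def)
  have "\<not> V l" using out by (auto simp: V_def)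
  \<comment> \<open>Outside the frame both are Void, so those cells are right although no sweep
    changes them.\<close>
  have Tr: "T b i = load \<rho> i" if "i < l \<or> r < i" for i
    using fr that load_outside[OF out lr that] by (auto simp: framed_def)
  have "(TrimL b (U r), tracks l r I T, r) \<leadsto>
      (TrimL b (U 0), tracks l r I T1, 0)"
  proof (rule sweep_left[where q = "\<lambda>i. TrimL b (U i)"])
    show "\<delta> (TrimL b (U i)) (tracks l r I T i) = Some (TrimL b (U (i - 1)), tracks l r I T1 i, MoveLeft)"
      if "0 < i" "i \<le> r" for i
      using that lr loadU[of i] U[of i]
      by (simp add: tracks_def trim_def T1_def Let_def \<rho> fun_eq_iff)
    show "tracks l r I T1 i = tracks l r I T i" if "i \<le> 0 \<or> r < i" for i
      using that lr Tr[of i] by (auto simp: tracks_def T1_def fun_eq_iff)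
  qed (rule lr)
  also have "(TrimL b (U 0), tracks l r I T1, 0) \<leadsto> (LeftEnd b, tracks l r I T2, -1)"
    by (rule mstepI[where b = "tracks l r I T2 0" and d = MoveLeft])
      (auto simp: tracks_def trim_def T1_def T2_def Let_def load_zero \<rho> fun_eq_iff)
  also (rtranclp_trans) have "(LeftEnd b, tracks l r I T2, -1) \<leadsto>
      (LeftEnd b, tracks l r I T2, l - 1)"
    by (rule sweep_left) (use lr in \<open>auto simp: tracks_def\<close>)
  also (rtranclp_trans) have "(LeftEnd b, tracks l r I T2, l - 1) \<leadsto> (TrimR b (V l), tracks l r I T2, l)"
    by (rule mstepI[where b = "tracks l r I T2 (l - 1)" and d = MoveRight])
      (use lr \<open>\<not> V l\<close> in \<open>auto simp: tracks_def\<close>)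
  also (rtranclp_trans) have "(TrimR b (V l), tracks l r I T2, l) \<leadsto>
      (TrimR b (V 0), tracks l r I (T(b := load \<rho>)), 0)"
  proof (rule sweep_right[where q = "\<lambda>i. TrimR b (V i)"])
    show "\<delta> (TrimR b (V i)) (tracks l r I T2 i) =
        Some (TrimR b (V (i + 1)), tracks l r I (T(b := load \<rho>)) i, MoveRight)"
      if "l \<le> i" "i < 0" for i
      using that lr loadV[of i] V[of i]
      by (simp add: tracks_def trim_def T2_def Let_def \<rho> fun_eq_iff)
    show "tracks l r I (T(b := load \<rho>)) i = tracks l r I T2 i" if "i < l \<or> 0 \<le> i" for i
      using that lr Tr[of i] by (auto simp: tracks_def T2_def fun_eq_iff)
  qed (rule lr)
  also (rtranclp_trans) have "(TrimR b (V 0), tracks l r I (T(b := load \<rho>)), 0) \<leadsto>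
      (if b then Sim False 0 else SeekCmp, tracks l r I (T(b := load \<rho>)), 0)"
    by (rule mstepI[where b = "tracks l r I (T(b := load \<rho>)) 0" and d = Stay])
      (auto simp: tracks_def)
  finally (rtranclp_trans) show ?thesis using \<open>\<not> U r\<close> by simp
qed

lemma framed_update:
  assumes "framed l r I T" "\<And>i. i < l \<or> r < i \<Longrightarrow> v i = Void"
  shows "framed l r I (T(b := v))"
  using assms by (simp add: framed_def)

text \<open>The head is at most one cell outside the visited interval, so marking its cell yields an
  interval again.\<close>

lemma extend_frame:
  assumes "framed l r I T" "l - 1 \<le> h" "h \<le> r + 1"
  shows "framed (min l h) (max r h) I (T(b := (T b)(h := s)))"
    and "(tracks l r I T)(h := (touch (fst (tracks l r I T h)), I h, (\<lambda>k. T k h)(b := s)))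
      = tracks (min l h) (max r h) I (T(b := (T b)(h := s)))"
  using assms by (auto simp: framed_def tracks_def touch_def fun_eq_iff min_def max_def)

text \<open>A cell is marked when the machine acts on it, not when the head arrives; this is why the
  head may be one cell outside the frame.\<close>

lemma sim_run:
  assumes "(step (M b))\<^sup>*\<^sup>* (q, t, h) (q', t', h')"
    and "framed l r I T" "T b = t" "l - 1 \<le> h" "h \<le> r + 1"
  shows "\<exists>l' r'. framed l' r' I (T(b := t')) \<and> l' - 1 \<le> h' \<and> h' \<le> r' + 1 \<and>
    (Sim b q, tracks l r I T, h) \<leadsto> (Sim b q', tracks l' r' I (T(b := t')), h')"
  using assms
proof (induction "(q', t', h')" arbitrary: q' t' h' rule: rtranclp_induct)
  case base
  then show ?case by (intro exI[of _ l] exI[of _ r]) auto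
next
  case (step z)
  obtain q1 t1 h1 where z: "z = (q1, t1, h1)" by (cases z)
  obtain s d where *: "fmlookup (M b) (q1, t1 h1) = Some (q', s, d)" "t' = t1(h1 := s)" "h' = h1 + displacement d"
    using step.hyps(2) z by (auto simp: step_def)
  obtain l1 r1 where 1: "framed l1 r1 I (T(b := t1))" "l1 - 1 \<le> h1" "h1 \<le> r1 + 1"
    "(Sim b q, tracks l r I T, h) \<leadsto> (Sim b q1, tracks l1 r1 I (T(b := t1)), h1)"
    using step.hyps(3)[OF z step.prems] by blast
  note e = extend_frame[OF 1(1-3), of b s]
  have T: "(T(b := t1))(b := ((T(b := t1)) b)(h1 := s)) = T(b := t')"
    using * by simp
  have "(Sim b q1, tracks l1 r1 I (T(b := t1)), h1) \<leadsto>
      (Sim b q', tracks (min l1 h1) (max r1 h1) I (T(b := t')), h')"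
    by (rule mstepI[where d = d, OF _ e(2)[unfolded T, symmetric] *(3)])
      (use *(1) in \<open>auto simp: tracks_def\<close>)
  with 1(4) have "(Sim b q, tracks l r I T, h) \<leadsto>
      (Sim b q', tracks (min l1 h1) (max r1 h1) I (T(b := t')), h')"
    by (rule rtranclp_trans)
  moreover have "min l1 h1 - 1 \<le> h'" "h' \<le> max r1 h1 + 1"
    using * by (cases d; simp)+
  ultimately show ?case using e(1)[unfolded T] by blast
qed

text \<open>Trimming restores the form from which the run started, so that runs can be
  chained.\<close>

lemma apply_run:
  assumes "halts_with (M b) \<sigma> \<rho>" and fr: "framed l r I T" and T: "T b = load \<sigma>"
  shows "\<exists>l' r'. framed l' r' I (T(b := load \<rho>)) \<and>
    (Sim b 0, tracks l r I T, 0) \<leadsto>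
    (if b then Sim False 0 else SeekCmp, tracks l' r' I (T(b := load \<rho>)), 0)"
proof -
  obtain q t h where M: "(step (M b))\<^sup>*\<^sup>* (0, load \<sigma>, 0) (q, t, h)"
    "fmlookup (M b) (q, t h) = None" "\<And>i. fmlookup \<rho> i = content (t i)"
    using assms(1) by (auto simp: halts_with_def halted_def)
  obtain l1 r1 where 1: "framed l1 r1 I (T(b := t))" "l1 - 1 \<le> h" "h \<le> r1 + 1"
    "(Sim b 0, tracks l r I T, 0) \<leadsto> (Sim b q, tracks l1 r1 I (T(b := t)), h)"
    using sim_run[OF M(1) fr T] fr by (auto simp: framed_def)
  \<comment> \<open>The halting cell may still be Fresh and is marked on leaving \<open>Sim\<close>;
    otherwise, at the left end, seeking would stop there at once.\<close>
  define l' where "l' = min l1 h"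
  define r' where "r' = max r1 h"
  note e = extend_frame[OF 1(1-3), of b "t h"]
  have fr': "framed l' r' I (T(b := t))" using e(1) by (simp add: l'_def r'_def)
  have out: "load \<rho> i = Void" if "i < l' \<or> r' < i" for i
  proof -
    have "fmlookup \<rho> j = None" if "j < l' \<or> r' < j" for j
    proof -
      have "(T(b := t)) b j = Void" using fr' that by (auto simp: framed_def simp del: fun_upd_apply)
      then show ?thesis by (simp add: M(3))
    qed
    then show ?thesis by (rule load_outside) (use fr' that in \<open>auto simp: framed_def\<close>)
  qed
  note 1(4)
  also have "(Sim b q, tracks l1 r1 I (T(b := t)), h) \<leadsto> (SeekTrim b, tracks l' r' I (T(b := t)), h)"
    by (rule mstepI[where d = Stay and b = "tracks l' r' I (T(b := t)) h"])
      (use M(2) 1(2,3) in \<open>auto simp: tracks_def touch_def l'_def r'_def fun_eq_iff\<close>)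
  also (rtranclp_trans) have "(SeekTrim b, tracks l' r' I (T(b := t)), h) \<leadsto> (TrimL b False, tracks l' r' I (T(b := t)), r')"
    by (rule seek) (use fr' in \<open>auto simp: framed_def l'_def r'_def\<close>)
  also (rtranclp_trans) have "(TrimL b False, tracks l' r' I (T(b := t)), r') \<leadsto>
      (if b then Sim False 0 else SeekCmp, tracks l' r' I ((T(b := t))(b := load \<rho>)), 0)"
    by (rule trim_run[OF fr']) (simp add: M(3))
  finally (rtranclp_trans) have "(Sim b 0, tracks l r I T, 0) \<leadsto>
    (if b then Sim False 0 else SeekCmp, tracks l' r' I (T(b := load \<rho>)), 0)" by simp
  moreover have "framed l' r' I (T(b := load \<rho>))"
    using framed_update[OF fr', of "load \<rho>" b] out by simp
  ultimately show ?thesis by blast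
qed

text \<open>Tapes are equal iff all their cells agree, and outside the frame both are blank, so one
  sweep over the frame decides.\<close>

lemma compare_run:
  assumes fr: "framed l r (load \<tau>) (\<lambda>b. load (z b))" and h: "l \<le> h" "h \<le> r + 1"
  shows "(SeekCmp, tracks l r (load \<tau>) (\<lambda>b. load (z b)), h) \<leadsto>
    (if \<tau> = z True then Out else ToOrigin, tracks l r (load \<tau>) (\<lambda>b. load (z b)), l)"
proof -
  let ?t = "tracks l r (load \<tau>) (\<lambda>b. load (z b))"
  have lr: "l \<le> 0" "0 \<le> r" using fr by (auto simp: framed_def)
  \<comment> \<open>\<open>E i\<close> is the flag of \<open>Cmp\<close> on arrival at
    \<open>i\<close>; it starts as \<open>True\<close> because nothing differs to the right of
    \<open>r\<close>.\<close>
  define E where "E i \<longleftrightarrow> (\<forall>j>i. fmlookup \<tau> j = fmlookup (z True) j)" for i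
  have gt: "i - 1 < j \<longleftrightarrow> i \<le> j" for i j :: int by auto
  have E: "E (i - 1) \<longleftrightarrow> E i \<and> fmlookup \<tau> i = fmlookup (z True) i" for i
    unfolding E_def gt order_le_less by blast
  have out: "fmlookup \<tau> i = fmlookup (z True) i" if "i < l \<or> r < i" for i
    using fr that content_load[of \<tau> i] content_load[of "z True" i] by (auto simp: framed_def)
  have "E r" using out by (simp add: E_def)
  have "E (l - 1) \<longleftrightarrow> \<tau> = z True"
  proof
    assume "E (l - 1)"
    then have "fmlookup \<tau> i = fmlookup (z True) i" for i
      using out[of i] by (cases "i < l") (auto simp: E_def)
    then show "\<tau> = z True" by (rule fmap_ext)
  qed (simp add: E_def)
  note El = this
  have "(SeekCmp, ?t, h) \<leadsto> (Cmp (E r), ?t, r)"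
    by (rule seek) (use lr h \<open>E r\<close> in auto)
  also have "\<dots> \<leadsto> (Cmp (E (l - 1)), ?t, l - 1)"
  proof (rule sweep_left[where q = "\<lambda>i. Cmp (E i)"])
    show "\<delta> (Cmp (E i)) (?t i) = Some (Cmp (E (i - 1)), ?t i, MoveLeft)" if "l - 1 < i" "i \<le> r" for i
      using that unfolding E by (simp add: tracks_def content_load)
  qed (use lr in simp_all)
  also (rtranclp_trans) have "(Cmp (E (l - 1)), ?t, l - 1) \<leadsto> (if \<tau> = z True then Out else ToOrigin, ?t, l)"
    by (rule mstepI[where d = MoveRight and b = "?t (l - 1)"])
      (use lr in \<open>auto simp: tracks_def El\<close>)
  finally (rtranclp_trans) show ?thesis .
qed

lemma origin_run:
  assumes "l \<le> 0"
  shows "(ToOrigin, tracks l r I T, l) \<leadsto> (Sim True 0, tracks l r I T, 0)"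
proof -
  have "(ToOrigin, tracks l r I T, l) \<leadsto>
      (ToOrigin, tracks l r I T, 0)"
    by (rule sweep_right) (use assms in \<open>auto simp: tracks_def\<close>)
  also have "(ToOrigin, tracks l r I T, 0) \<leadsto> (Sim True 0, tracks l r I T, 0)"
    by (rule mstepI[where d = Stay and b = "tracks l r I T 0"]) (auto simp: tracks_def)
  finally (rtranclp_trans) show ?thesis .
qed

text \<open>Erasing the Origin mark and the other tracks leaves symbols that are later encoded as
  plain cells; on the Fresh cell \<open>r + 1\<close> the machine halts.\<close>

lemma output_run:
  assumes fr: "framed l r I T"
  shows "(Out, tracks l r I T, l) \<leadsto>
    (Out, \<lambda>i. if l \<le> i \<and> i < r + 1 then (Visited, Cell (content (T False i)), \<lambda>b. Void) else tracks l r I T i, r + 1)"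
  by (rule sweep_right) (use fr in \<open>auto simp: tracks_def framed_def\<close>)

text \<open>The tape whose encoding in \<open>search_computable\<close> is
  \<open>load \<tau>\<close>. It has no Origin mark; \<open>InitRight 0\<close> sets it.\<close>

definition fresh :: "'s tape \<Rightarrow> int \<Rightarrow> 's sym" where
  "fresh \<tau> i = (if i \<in> extent \<tau> then Visited else Fresh, load \<tau> i, \<lambda>b. Void)"

lemma init_run:
  "\<exists>l r h. framed l r (load \<tau>) (\<lambda>b. load (c b)) \<and> l \<le> h \<and> h \<le> r + 1 \<and>
    (InitLeft 0, fresh \<tau>, 0) \<leadsto> (SeekCmp, tracks l r (load \<tau>) (\<lambda>b. load (c b)), h)"
proof -
  obtain l0 r0 where 0: "l0 \<le> 0" "0 \<le> r0" "extent \<tau> = {l0..r0}"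
    using extent_interval by blast
  \<comment> \<open>The extent of the input and \<open>{-N..N}\<close> both contain the origin, so
    their union is an interval.\<close>
  define l where "l = min l0 (-N)"
  define r where "r = max r0 N"
  let ?t = "tracks l r (load \<tau>) (\<lambda>b. load (c b))"
  have out: "load (c b) i = Void" if "i < -N \<or> N < i" for b i
    using N(2)[of b] that by (auto simp: load_def)
  have fr: "framed l r (load \<tau>) (\<lambda>b. load (c b))"
    using 0 N(1) out by (auto simp: framed_def l_def r_def load_def)
  have "(InitLeft 0, fresh \<tau>, 0) \<leadsto>
      (InitLeft (-N), fresh \<tau>, -N)"
    by (rule sweep_left[where q = InitLeft]) (use N(1) in auto)
  also have "(InitLeft (-N), fresh \<tau>, -N) \<leadsto> (InitRight (-N), fresh \<tau>, -N)"
    by (rule mstepI[where d = Stay and b = "fresh \<tau> (-N)"]) auto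
  also (rtranclp_trans) have "(InitRight (-N), fresh \<tau>, -N) \<leadsto> (SeekCmp, ?t, N + 1)"
  proof -
    let ?q = "\<lambda>i. if i \<le> N then InitRight i else SeekCmp"
    have "(?q (-N), fresh \<tau>, -N) \<leadsto> (?q (N + 1), ?t, N + 1)"
    proof (rule sweep_right)
      show "\<delta> (?q i) (fresh \<tau> i) = Some (?q (i + 1), ?t i, MoveRight)" if "-N \<le> i" "i < N + 1" for i
        using that 0 N(1) by (auto simp: fresh_def tracks_def l_def r_def)
      show "?t i = fresh \<tau> i" if "i < -N \<or> N + 1 \<le> i" for i
        using that 0 N(1) out by (auto simp: fun_eq_iff fresh_def tracks_def l_def r_def)
    qed (use N(1) in simp)
    then show ?thesis using N(1) by simp
  qed
  finally (rtranclp_trans) have "(InitLeft 0, fresh \<tau>, 0) \<leadsto> (SeekCmp, ?t, N + 1)" by simp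
  moreover have "l \<le> N + 1" "N + 1 \<le> r + 1" using N(1) by (auto simp: l_def r_def)
  ultimately show ?thesis using fr by blast
qed

text \<open>Induction on the number \<open>k\<close> of rounds that suffice. The search stops at the
  first match, so \<open>j\<close> need not be \<open>n + k\<close>.\<close>

lemma search_run:
  assumes M: "\<And>b j. halts_with (M b) (z j b) (z (Suc j) b)"
    and "z (n + k) True = \<tau>"
    and "framed l r (load \<tau>) (\<lambda>b. load (z n b))" "l \<le> h" "h \<le> r + 1"
  shows "\<exists>j l' r'. z j True = \<tau> \<and> framed l' r' (load \<tau>) (\<lambda>b. load (z j b)) \<and>
    (SeekCmp, tracks l r (load \<tau>) (\<lambda>b. load (z n b)), h) \<leadsto>
    (Out, tracks l' r' (load \<tau>) (\<lambda>b. load (z j b)), l')"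
  using assms(2-)
proof (induction k arbitrary: n l r h)
  case (0 n l r h)
  then show ?case using compare_run[of l r \<tau> "z n" h] by (intro exI[of _ n]) auto
next
  case (Suc k n l r h)
  let ?t = "\<lambda>l r z. tracks l r (load \<tau>) (\<lambda>b. load (z b))"
  show ?case
  proof (cases "z n True = \<tau>")
    case True
    then show ?thesis using compare_run[of l r \<tau> "z n" h] Suc.prems by (intro exI[of _ n]) auto
  next
    case False
    have "l \<le> 0" using Suc.prems(2) by (simp add: framed_def)
    have "(SeekCmp, ?t l r (z n), h) \<leadsto> (ToOrigin, ?t l r (z n), l)"
      using compare_run[of l r \<tau> "z n" h] Suc.prems False by auto
    also have "\<dots> \<leadsto> (Sim True 0, ?t l r (z n), 0)"
      using \<open>l \<le> 0\<close> by (rule origin_run)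
    finally (rtranclp_trans) have 0: "(SeekCmp, ?t l r (z n), h) \<leadsto> (Sim True 0, ?t l r (z n), 0)" .
    \<comment> \<open>Halfway through a round only track \<open>True\<close> has advanced.\<close>
    define T where "T = (\<lambda>b. load (z n b))(True := load (z (Suc n) True))"
    obtain l1 r1 where 1: "framed l1 r1 (load \<tau>) T"
      "(Sim True 0, ?t l r (z n), 0) \<leadsto> (Sim False 0, tracks l1 r1 (load \<tau>) T, 0)"
      using apply_run[OF M[of True n] Suc.prems(2)] by (auto simp: T_def)
    have T: "T(False := load (z (Suc n) False)) = (\<lambda>b. load (z (Suc n) b))"
      by (auto simp: T_def fun_eq_iff)
    obtain l2 r2 where 2: "framed l2 r2 (load \<tau>) (\<lambda>b. load (z (Suc n) b))"
      "(Sim False 0, tracks l1 r1 (load \<tau>) T, 0) \<leadsto> (SeekCmp, ?t l2 r2 (z (Suc n)), 0)"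
      using apply_run[OF M[of False n] 1(1)] T by (auto simp: T_def)
    have "l2 \<le> 0" "0 \<le> r2 + 1" using 2(1) by (auto simp: framed_def)
    moreover have "z (Suc n + k) True = \<tau>" using Suc.prems(1) by simp
    ultimately obtain j l' r' where j: "z j True = \<tau>" "framed l' r' (load \<tau>) (\<lambda>b. load (z j b))"
      "(SeekCmp, ?t l2 r2 (z (Suc n)), 0) \<leadsto> (Out, ?t l' r' (z j), l')"
      using Suc.IH[OF _ 2(1), of 0] by auto
    then show ?thesis
      using rtranclp_trans[OF 0 rtranclp_trans[OF 1(2) rtranclp_trans[OF 2(2) j(3)]]] by blast
  qed
qed

section \<open>Finiteness and encoding of the search machine\<close>

definition cells :: "'s cell set" where
  "cells = insert Void (range Cell \<union> (\<Union>b. (fst \<circ> snd) ` fmran' (M b)))"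

definition syms :: "'s sym set" where
  "syms = UNIV \<times> cells \<times> (UNIV \<rightarrow> cells)"

definition ctrls :: "ctrl set" where
  "ctrls = InitLeft ` {-N..N} \<union> InitRight ` {-N..N} \<union> {SeekCmp, ToOrigin, Out}
     \<union> range SeekTrim \<union> range Cmp \<union> range LeftEnd
     \<union> (\<Union>b. Sim b ` insert 0 (\<Union>b. fst ` fmran' (M b)) \<union> range (TrimL b) \<union> range (TrimR b))"

lemma finite_fmran': "finite (fmran' m)"
  by (metis fmran'_alt_def finite_fset)

lemma finite_cells: "finite cells"
  by (simp add: cells_def finite_fmran')

lemma finite_syms: "finite syms"
proof -
  have "finite (PiE (UNIV :: bool set) (\<lambda>_. cells))"
    by (rule finite_PiE) (auto simp: finite_cells)
  moreover have "finite (UNIV :: mark set)"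
  proof (rule finite_subset)
    show "UNIV \<subseteq> {Fresh, Visited, Origin}" using mark.exhaust by blast
  qed simp
  moreover have "(UNIV \<rightarrow> cells) = PiE (UNIV :: bool set) (\<lambda>_. cells)"
    by (simp add: PiE_def)
  ultimately show ?thesis
    unfolding syms_def by (metis finite_cells finite_cartesian_product)
qed

lemma finite_ctrls: "finite ctrls"
  by (simp add: ctrls_def finite_fmran')

lemma cells_intros: "Cell s \<in> cells" "Void \<in> cells" "load \<tau> i \<in> cells"
  by (auto simp: cells_def load_def)

lemma ctrls_iff:
  "InitLeft k \<in> ctrls \<longleftrightarrow> k \<in> {-N..N}" "InitRight k \<in> ctrls \<longleftrightarrow> k \<in> {-N..N}"
  "SeekCmp \<in> ctrls" "ToOrigin \<in> ctrls" "Out \<in> ctrls"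
  "SeekTrim b \<in> ctrls" "Cmp f \<in> ctrls" "LeftEnd b \<in> ctrls" "TrimL b f \<in> ctrls" "TrimR b f \<in> ctrls"
  "Sim b q \<in> ctrls \<longleftrightarrow> q \<in> insert 0 (\<Union>b. fst ` fmran' (M b))"
  by (simp_all add: ctrls_def image_iff) blast

text \<open>Only the simulation takes states and symbols from the tables; all other phases write
  loaded, trimmed or unchanged cells.\<close>

lemma delta_closed:
  assumes "q \<in> ctrls" "s \<in> syms" "\<delta> q s = Some (q', s', d)"
  shows "q' \<in> ctrls \<and> s' \<in> syms"
proof -
  have M: "a \<in> (\<Union>b. fst ` fmran' (M b))" "v \<in> cells" if "fmlookup (M b) k = Some (a, v, e)" for a v e k b
    using fmran'I[OF that] by (force simp: cells_def)+
  obtain m a T where s: "s = (m, a, T)" by (cases s)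
  show ?thesis
  proof (cases "\<exists>b k. q = Sim b k")
    case True
    then obtain b k where q: "q = Sim b k" by blast
    show ?thesis
    proof (cases "fmlookup (M b) (k, T b)")
      case None
      then show ?thesis using assms by (auto simp: s q ctrls_iff syms_def)
    next
      case (Some v)
      obtain k' c' d' where v: "v = (k', c', d')" by (cases v)
      have "T(b := c') \<in> UNIV \<rightarrow> cells"
        using assms(2) M(2)[OF Some[unfolded v]] by (auto simp: s syms_def)
      moreover have "Sim b k' \<in> ctrls"
        using M(1)[OF Some[unfolded v]] unfolding ctrls_iff by blast
      ultimately show ?thesis
        using assms(2,3) Some v by (auto simp: s q syms_def)
    qed
  next
    case False
    with assms N(1) s show ?thesis
      by (cases q) (auto simp: ctrls_iff syms_def cells_intros trim_def Let_def split: if_splits)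
  qed
qed

text \<open>Each input occurs in the sequence, so the search ends; the second condition on
  \<open>f\<close> makes the output right at whatever index it stops.\<close>

lemma search_computable:
  assumes M: "\<And>b j. halts_with (M b) (z j b) (z (Suc j) b)" and c: "c = z 0"
    and f: "\<And>\<tau>. \<tau> \<in> Q \<Longrightarrow> \<exists>k. z k True = \<tau>" "\<And>j. z j True \<in> Q \<Longrightarrow> f (z j True) = z j False"
  shows "computable_on Q f"
proof -
  define blank where "blank = (\<lambda>_ :: bool. Void :: 's cell)"
  obtain aux :: "'s sym \<Rightarrow> nat" where aux: "inj_on aux syms"
    using finite_imp_inj_to_nat_seg[OF finite_syms] by blast
  \<comment> \<open>Plain symbols are encoded by their input cell, so that input and output can be
    read off directly; all others get \<open>Aux\<close> codes, which no plain symbol uses.\<close>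
  define plain where "plain m a T \<longleftrightarrow> T = blank \<and> (m = Visited \<and> a \<in> range Cell \<or> m = Fresh \<and> a = Void)"
    for m and a :: "'s cell" and T
  define enc where "enc = (\<lambda>(m, a, T). if plain m a T then a else Aux (aux (m, a, T)))"
  have enc: "inj_on enc syms"
  proof (rule inj_onI)
    fix s s' assume s: "s \<in> syms" "s' \<in> syms" and eq: "enc s = enc s'"
    obtain m a T m' a' T' where *: "s = (m, a, T)" "s' = (m', a', T')" by (metis surj_pair)
    have "plain m a T \<longleftrightarrow> plain m' a' T'"
      using eq by (auto simp: * enc_def plain_def split: if_splits)
    then show "s = s'"
      using eq s inj_onD[OF aux, of s s'] by (cases "plain m a T") (auto simp: * enc_def plain_def)
  qed
  have enc_content: "content (enc (m, a, T)) = (if m = Visited \<and> T = blank then content a else None)" for m a T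
    by (cases a) (auto simp: enc_def plain_def)
  have init: "InitLeft 0 \<in> ctrls" using N(1) by (auto simp: ctrls_def)
  show ?thesis
  proof (rule finite_machine_encoding[where \<delta> = \<delta>, OF finite_ctrls finite_syms init _ enc])
    fix M' :: "'s tm"
    assume M': "\<And>t q t' h' \<rho> \<tau>. (InitLeft 0, t, 0) \<leadsto> (q, t', h') \<Longrightarrow> range t \<subseteq> syms \<Longrightarrow>
       \<delta> q (t' h') = None \<Longrightarrow> load \<tau> = enc \<circ> t \<Longrightarrow>
       (\<And>i. fmlookup \<rho> i = content (enc (t' i))) \<Longrightarrow> halts_with M' \<tau> \<rho>"
    have "halts_with M' \<tau> (f \<tau>)" if \<tau>: "\<tau> \<in> Q" for \<tau>
    proof -
      obtain k where k: "z (0 + k) True = \<tau>" using f(1)[OF \<tau>] by auto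
      obtain l r h where 0: "framed l r (load \<tau>) (\<lambda>b. load (z 0 b))" "l \<le> h" "h \<le> r + 1"
        "(InitLeft 0, fresh \<tau>, 0) \<leadsto> (SeekCmp, tracks l r (load \<tau>) (\<lambda>b. load (z 0 b)), h)"
        using init_run[of \<tau>] c by auto
      obtain j l' r' where 1: "z j True = \<tau>" "framed l' r' (load \<tau>) (\<lambda>b. load (z j b))"
        "(SeekCmp, tracks l r (load \<tau>) (\<lambda>b. load (z 0 b)), h) \<leadsto>
          (Out, tracks l' r' (load \<tau>) (\<lambda>b. load (z j b)), l')"
        using search_run[OF M k 0(1-3)] by blast
      have lr: "l' \<le> 0" "0 \<le> r'" using 1(2) by (auto simp: framed_def)
      have out: "fmlookup (z j False) i = None" if "i < l' \<or> r' < i" for i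
        using 1(2) that content_load[of "z j False" i] by (auto simp: framed_def)
      show ?thesis
      proof (rule M'[OF rtranclp_trans[OF 0(4) rtranclp_trans[OF 1(3) output_run[OF 1(2)]]]])
        show "range (fresh \<tau>) \<subseteq> syms"
          by (auto simp: fresh_def syms_def cells_intros)
        show "load \<tau> = enc \<circ> fresh \<tau>"
          by (auto simp: fun_eq_iff fresh_def load_def enc_def plain_def blank_def)
        \<comment> \<open>Outside the frame the cells are Fresh and read as blank, as
          \<open>z j False\<close> is there.\<close>
        show "fmlookup (f \<tau>) i = content (enc (if l' \<le> i \<and> i < r' + 1
            then (Visited, Cell (content (load (z j False) i)), \<lambda>b. Void)
            else tracks l' r' (load \<tau>) (\<lambda>b. load (z j b)) i))" for i
          using out[of i] f(2)[of j] \<tau> 1(1) lr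
          by (auto simp: tracks_def enc_content content_load blank_def)
      qed (use lr in \<open>simp add: tracks_def\<close>)
    qed
    then show "computable_on Q f" unfolding computable_on_def by blast
  qed (rule delta_closed)
qed

end

section \<open>Translation along the enumeration\<close>

lemma enumeration_translation:
  fixes x y :: "'a \<Rightarrow> ('s::finite) tape"
  assumes e: "enumerator A e" and x: "inj_on x A" and y: "inj_on y A"
    and ex: "e \<in> comp_wrt A x" and ey: "e \<in> comp_wrt A y"
  shows "computable_on (x ` A) (y \<circ> inv_into A x)"
proof -
  obtain a0 where a0: "a0 \<in> A" "\<And>a. a \<in> A \<Longrightarrow> \<exists>i. a = (e ^^ i) a0" and eA: "e \<in> A \<rightarrow> A"
    using e by (auto simp: enumerator_def)
  have A: "(e ^^ i) a0 \<in> A" for i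
    using a0(1) eA by (induction i) auto
  obtain Mx where Mx: "\<And>\<tau>. \<tau> \<in> x ` A \<Longrightarrow> halts_with Mx \<tau> ((x \<circ> e \<circ> inv_into A x) \<tau>)"
    using ex by (auto simp: comp_wrt_def computable_on_def)
  obtain My where My: "\<And>\<tau>. \<tau> \<in> y ` A \<Longrightarrow> halts_with My \<tau> ((y \<circ> e \<circ> inv_into A y) \<tau>)"
    using ey by (auto simp: comp_wrt_def computable_on_def)
  \<comment> \<open>The orbit of \<open>a0\<close> under both representations, \<open>True\<close>
    being the side of \<open>x\<close>.\<close>
  define z where "z j b = (if b then x else y) ((e ^^ j) a0)" for j b
  have "halts_with (if b then Mx else My) (z j b) (z (Suc j) b)" for b j
    using Mx[of "x ((e ^^ j) a0)"] My[of "y ((e ^^ j) a0)"] A[of j] x y by (auto simp: z_def)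
  moreover obtain N where "0 \<le> N" "\<And>b. extent (z 0 b) \<subseteq> {-N..N}"
  proof -
    have "\<forall>b. \<exists>l r. l \<le> 0 \<and> 0 \<le> r \<and> extent (z 0 b) = {l..r}"
      using extent_interval by blast
    then obtain l r where lr: "\<And>b. l b \<le> 0 \<and> 0 \<le> r b \<and> extent (z 0 b) = {l b..r b}"
      by metis
    \<comment> \<open>Each extent contains the origin, so its width bounds the distance of its cells
      from there; the sum serves both tracks.\<close>
    let ?N = "\<Sum>b\<in>UNIV. r b - l b"
    have le: "l b \<le> r b" for b using lr[of b] by linarith
    have N: "r b - l b \<le> ?N" for b
      by (rule member_le_sum) (use le in simp_all)
    have "0 \<le> ?N" by (rule sum_nonneg) (use le in simp_all)
    moreover have "extent (z 0 b) \<subseteq> {-?N..?N}" for b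
      using N[of b] lr[of b] by auto
    ultimately show thesis by (rule that)
  qed
  ultimately interpret search "\<lambda>b. if b then Mx else My" "z 0" N
    by unfold_locales
  show ?thesis
  proof (rule search_computable[where z = z])
    show "halts_with (if b then Mx else My) (z j b) (z (Suc j) b)" for b j by fact
    show "\<exists>k. z k True = \<tau>" if "\<tau> \<in> x ` A" for \<tau>
      using that a0(2) by (auto simp: z_def)
    \<comment> \<open>Injectivity of \<open>x\<close> recovers the orbit element from its
      tape.\<close>
    show "(y \<circ> inv_into A x) (z j True) = z j False" for j
      using A[of j] x by (simp add: z_def)
  qed simp
qed

theorem theorem12:
  fixes p :: "('s::finite) tape \<times> 's tape \<Rightarrow> 's tape"
    and A :: "'a set" and e :: "'a \<Rightarrow> 'a"
    and x y :: "'a \<Rightarrow> 's tape"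
  assumes "computable_pairing p"
    and "countable A"
    and "enumerator A e"
    and "representation A x" and "representation A y"
    and "e \<in> comp_wrt A x" and "e \<in> comp_wrt A y"
  shows "transformationally_equivalent A x y"
  using assms enumeration_translation[of A e x y] enumeration_translation[of A e y x]
  by (simp add: transformationally_equivalent_def representation_def)

end
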